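(* Let $\varepsilon\in(0,2^{-10})$ and let $p=p(n)$ satisfy $(\log n)^{2+\varepsilon}n^{-1}\le p<n^{-\varepsilon}$. Let $G$ be an $n$-vertex $(\varepsilon,p)$-typical graph and $k=\varepsilon2^{-10}p^{-1}\log pn$. Then for all sufficiently large $n$ the following holds: with probability at least $1-n^{-2^{-11}\log pn}$, in the random greedy independent set process on $G$ we have \[ d_i(v)=(1\pm f_i)\widetilde d_i\qquad\text{for all } v\in V_i \text{ and all } i\in[k-1]. \]
   Context: All logarithms are natural; roundings are ignored; $[m]=\{1,\dots,m\}$; $x=a\pm b$ means $x\in[a-b,a+b]$. For $S\subseteq V(G)$, $N^c_G(S)=V(G)\setminus\bigcup_{w\in S}(\{w\}\cup N_G(w))$. Random greedy independent set process on $G$: choose $v_1$ uniformly from $V(G)$; for $i\ge2$ choose $v_i$ uniformly from $N^c_G(\{v_1,\dots,v_{i-1}\})$, stopping if it is empty. Set $V_0=V(G)$, $V_i=N^c_G(\{v_1,\dots,v_i\})$, $G_i=G[V_i]$, and for $v\in V_i$ let $d_i(v)$ be the degree of $v$ in $G_i$. Let $\widetilde d_i=(1-p)^ipn$, $f_0=4\log n\sqrt{\frac{\log pn}{pn}+p}$, $f_i=\big(\frac{1+16p}{1-p}\big)^i f_0$. An $n$-vertex graph $G$ is $(\varepsilon,p)$-typical if: (P1) for every $S\subseteq V(G)$ with $|S|\le\varepsilon p^{-1}\log pn$, $|N^c_G(S)|=(1\pm f_{|S|})(1-p)^{|S|}n$; (P2) every vertex $v$ has $d_G(v)=(1\pm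 f_0/2)pn$; (P3) all distinct $u,v$ have $|N_G(u)\cap N_G(v)|\le 4p^2n+2^7\log n$. *)

theory Defs
  imports "HOL-Probability.Probability" "Graph_Theory.Graph_Theory"
begin

text \<open>
  A finite simple graph is a \<open>G :: 'a pair_pre_digraph\<close> with \<open>pair_graph G\<close>: a finite vertex set
  \<open>pverts G\<close> and a symmetric, loop-free set \<open>parcs G\<close> of ordered pairs of vertices (each edge
  appears in both orientations, so the degree of a vertex is its out-degree).
\<close>

definition nbhd :: "'a pair_pre_digraph \<Rightarrow> 'a \<Rightarrow> 'a set" where
  "nbhd G v = {u. (v, u) \<in> parcs G}"

definition non_nbhd :: "'a pair_pre_digraph \<Rightarrow> 'a set \<Rightarrow> 'a set" where
  "non_nbhd G S = pverts G - (\<Union>w\<in>S. {w} \<union> nbhd G w)"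

definition degree_in :: "'a pair_pre_digraph \<Rightarrow> 'a set \<Rightarrow> 'a \<Rightarrow> nat" where
  "degree_in G S v = out_degree (with_proj G \<restriction> S) v"

definition d_tilde :: "nat \<Rightarrow> real \<Rightarrow> nat \<Rightarrow> real" where
  "d_tilde n p i = (1 - p) ^ i * p * real n"

definition f_err :: "nat \<Rightarrow> real \<Rightarrow> nat \<Rightarrow> real" where
  "f_err n p i = ((1 + 16 * p) / (1 - p)) ^ i *
     (4 * ln (real n) * sqrt (ln (p * real n) / (p * real n) + p))"

definition typical :: "real \<Rightarrow> real \<Rightarrow> 'a pair_pre_digraph \<Rightarrow> bool" where
  "typical \<epsilon> p G \<longleftrightarrow>
    (let n = card (pverts G) in
      (\<forall>S \<subseteq> pverts G. real (card S) \<le> \<epsilon> * inverse p * ln (p * real n) \<longrightarrow>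
         real (card (non_nbhd G S)) \<in>
           {(1 - f_err n p (card S)) * ((1 - p) ^ card S * real n) ..
            (1 + f_err n p (card S)) * ((1 - p) ^ card S * real n)}) \<and>
      (\<forall>v \<in> pverts G. real (out_degree (with_proj G) v) \<in>
         {(1 - f_err n p 0 / 2) * (p * real n) .. (1 + f_err n p 0 / 2) * (p * real n)}) \<and>
      (\<forall>u \<in> pverts G. \<forall>v \<in> pverts G. u \<noteq> v \<longrightarrow>
         real (card (nbhd G u \<inter> nbhd G v)) \<le> 4 * p\<^sup>2 * real n + 2 ^ 7 * ln (real n)))"

text \<open>
  The state of the random greedy independent set process is the list \<open>[v\<^sub>1, \<dots>, v\<^sub>i]\<close> of vertices
  chosen so far; once no vertex is available the state no longer changes.
\<close>

definition greedy_step :: "'a pair_pre_digraph \<Rightarrow> 'a list \<Rightarrow> 'a list pmf" where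
  "greedy_step G vs =
    (if non_nbhd G (set vs) = {} then return_pmf vs
     else map_pmf (\<lambda>v. vs @ [v]) (pmf_of_set (non_nbhd G (set vs))))"

primrec greedy_run :: "'a pair_pre_digraph \<Rightarrow> nat \<Rightarrow> 'a list pmf" where
  "greedy_run G 0 = return_pmf []"
| "greedy_run G (Suc i) = bind_pmf (greedy_run G i) (greedy_step G)"

text \<open>
  Every step before the process stops uses up a vertex, so after \<open>card (pverts G)\<close> steps it has
  stopped (lemma \<open>greedy_process_stopped\<close>): this is the law of the complete sequence of choices.
\<close>

definition greedy_process :: "'a pair_pre_digraph \<Rightarrow> 'a list pmf" where
  "greedy_process G = greedy_run G (card (pverts G))"

text \<open>
  \<open>V\<^sub>i\<close> for the sequence of choices \<open>vs\<close>.  If the process stops before step \<open>i\<close>, then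
  \<open>take i vs = vs\<close> and this set is empty.
\<close>

definition avail :: "'a pair_pre_digraph \<Rightarrow> 'a list \<Rightarrow> nat \<Rightarrow> 'a set" where
  "avail G vs i = non_nbhd G (set (take i vs))"

lemma greedy_run_invariant:
  assumes "finite (pverts G)" "vs \<in> set_pmf (greedy_run G i)"
  shows "set vs \<subseteq> pverts G \<and> distinct vs \<and> (non_nbhd G (set vs) = {} \<or> length vs = i)"
  using assms(2)
proof (induction i arbitrary: vs)
  case 0
  then show ?case by simp
next
  case (Suc i)
  then obtain us where us: "us \<in> set_pmf (greedy_run G i)" "vs \<in> set_pmf (greedy_step G us)"
    by auto
  show ?case
  proof (cases "non_nbhd G (set us) = {}")
    case True
    then show ?thesis using us Suc.IH[OF us(1)] by (simp add: greedy_step_def)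
  next
    case False
    have "finite (non_nbhd G (set us))" using assms(1) by (simp add: non_nbhd_def)
    with False us(2) obtain v where "v \<in> non_nbhd G (set us)" "vs = us @ [v]"
      by (auto simp: greedy_step_def)
    then show ?thesis using False Suc.IH[OF us(1)] by (auto simp: non_nbhd_def)
  qed
qed

lemma greedy_process_stopped:
  assumes "finite (pverts G)" "vs \<in> set_pmf (greedy_process G)"
  shows "non_nbhd G (set vs) = {}"
proof (rule ccontr)
  assume ne: "non_nbhd G (set vs) \<noteq> {}"
  have *: "set vs \<subseteq> pverts G" "distinct vs" "length vs = card (pverts G)"
    using greedy_run_invariant[OF assms(1)] assms(2) ne by (auto simp: greedy_process_def)
  then have "set vs = pverts G"
    using assms(1) by (metis card_subset_eq distinct_card)
  with ne show False by (auto simp: non_nbhd_def)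
qed

end

theory Submission
  imports Defs "HOL-Real_Asymp.Real_Asymp"
begin

text \<open>
  Fix a vertex \<open>v\<close> and consider the rescaled degree \<open>d\<^sub>i(v) / (1 - p)\<^sup>i\<close>.  As long as all degrees are
  in their windows, the expected loss of \<open>d\<^sub>i(v)\<close> in one step is \<open>(1 \<plusminus> 3 f\<^sub>i) p d\<^sub>i(v)\<close>: it is a sum of
  degrees over the neighbours of \<open>v\<close>, divided by \<open>|V\<^sub>i|\<close>.  The windows, rescaled in the same way, widen
  by \<open>17 p f\<^sub>i / (1 - p)\<close> times \<open>pn\<close>, which leaves a drift towards the inside.  The
  loss in one step is at most the codegree bound \<open>C = 4 p\<^sup>2 n + 2\<^sup>7 log n\<close>, so with \<open>h = f\<^sub>0 / C\<close>
  this drift outweighs the second-order term of the exponential moment, and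
  \<open>exp (h (d\<^sub>i(v) / (1 - p)\<^sup>i - (1 + f\<^sub>i) pn))\<close> is a supermartingale until something fails; likewise for the
  lower bound.  It starts below \<open>exp (- h f\<^sub>0 pn / 2) \<le> exp (- (log n log pn) / 16)\<close> and exceeds \<open>1\<close>
  when \<open>v\<close> leaves its window, which is enough for a union bound over times and vertices.
\<close>

section \<open>Neighbourhoods and degrees\<close>

context pair_graph
begin

lemma nbhd_sym: "u \<in> nbhd G v \<longleftrightarrow> v \<in> nbhd G u"
  using pair_sym_arcs by (auto simp: nbhd_def symmetric_def sym_def)

lemma nbhd_subset: "nbhd G v \<subseteq> pverts G"
  using in_arcsD2 by (auto simp: nbhd_def)

lemma finite_nbhd: "finite (nbhd G v)"
  using nbhd_subset pair_finite_verts by (rule finite_subset)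

lemma out_degree_eq_card_nbhd: "out_degree (with_proj G) v = card (nbhd G v)"
proof -
  have "out_arcs (with_proj G) v = Pair v ` nbhd G v"
    by (auto simp: out_arcs_def nbhd_def)
  then show ?thesis
    by (simp add: out_degree_def card_image inj_on_def)
qed

lemma degree_in_eq_card:
  assumes "v \<in> S"
  shows "degree_in G S v = card (nbhd G v \<inter> S)"
proof -
  have "out_arcs (with_proj G \<restriction> S) v = Pair v ` (nbhd G v \<inter> S)"
    using assms by (auto simp: out_arcs_def nbhd_def induce_subgraph_def)
  then show ?thesis
    by (simp add: degree_in_def out_degree_def card_image inj_on_def)
qed

lemma finite_non_nbhd: "finite (non_nbhd G S)"
  using pair_finite_verts by (simp add: non_nbhd_def)

lemma non_nbhd_insert: "non_nbhd G (insert u S) = non_nbhd G S - insert u (nbhd G u)"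
  by (auto simp: non_nbhd_def)

text \<open>Survival of \<open>v\<close> forces \<open>u\<close> to be a non-neighbour of
  \<open>v\<close>, so only common neighbours of \<open>u\<close> and \<open>v\<close> are lost: one
  step lowers a surviving degree by a codegree, never by a whole degree.\<close>

lemma card_nbhd_non_nbhd_insert:
  assumes "v \<in> non_nbhd G (insert u S)"
  shows "real (card (nbhd G v \<inter> non_nbhd G (insert u S))) =
    real (card (nbhd G v \<inter> non_nbhd G S)) - real (card (nbhd G u \<inter> nbhd G v \<inter> non_nbhd G S))"
proof -
  have "u \<notin> nbhd G v"
    using assms nbhd_sym by (auto simp: non_nbhd_insert)
  then have "nbhd G v \<inter> non_nbhd G (insert u S) =
      (nbhd G v \<inter> non_nbhd G S) - (nbhd G u \<inter> nbhd G v \<inter> non_nbhd G S)"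
    by (auto simp: non_nbhd_insert)
  moreover have "card (nbhd G u \<inter> nbhd G v \<inter> non_nbhd G S) \<le> card (nbhd G v \<inter> non_nbhd G S)"
    by (rule card_mono) (auto simp: finite_nbhd)
  ultimately show ?thesis
    by (simp add: card_Diff_subset finite_nbhd Int_lower2 le_infI1 of_nat_diff)
qed

text \<open>Double counting of the paths \<open>u - w - v\<close> inside \<open>V\<close> by their
  middle vertex \<open>w\<close>. The \<open>- 1\<close> removes the degenerate path with
  \<open>u = v\<close>, which every \<open>w\<close> carries.\<close>

lemma sum_codegree:
  assumes "finite V" "v \<in> V"
  shows "(\<Sum>u\<in>V - {v}. real (card (nbhd G u \<inter> nbhd G v \<inter> V))) =
    (\<Sum>w\<in>nbhd G v \<inter> V. real (card (nbhd G w \<inter> V)) - 1)"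
proof -
  have "(\<Sum>u\<in>V - {v}. real (card (nbhd G u \<inter> nbhd G v \<inter> V))) =
      (\<Sum>u\<in>V - {v}. \<Sum>w\<in>nbhd G v \<inter> V. of_bool (w \<in> nbhd G u))"
    by (intro sum.cong refl) (simp add: finite_nbhd sum_of_bool_eq Int_def conj_ac)
  also have "\<dots> = (\<Sum>w\<in>nbhd G v \<inter> V. \<Sum>u\<in>V - {v}. of_bool (w \<in> nbhd G u))"
    by (rule sum.swap)
  also have "\<dots> = (\<Sum>w\<in>nbhd G v \<inter> V. real (card (nbhd G w \<inter> V)) - 1)"
  proof (rule sum.cong[OF refl])
    fix w assume w: "w \<in> nbhd G v \<inter> V"
    have "(\<Sum>u\<in>V - {v}. of_bool (w \<in> nbhd G u)) = real (card ((nbhd G w \<inter> V) - {v}))"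
    proof -
      have "(V - {v}) \<inter> {u. w \<in> nbhd G u} = (nbhd G w \<inter> V) - {v}"
        using nbhd_sym[of w] by blast
      then show ?thesis using assms by simp
    qed
    also have "\<dots> = real (card (nbhd G w \<inter> V)) - 1"
    proof -
      have "v \<in> nbhd G w \<inter> V" using w assms nbhd_sym[of v w] by blast
      moreover from this have "card (nbhd G w \<inter> V) > 0"
        using finite_nbhd card_gt_0_iff by blast
      ultimately show ?thesis by (simp add: card_Diff_singleton of_nat_diff Suc_leI)
    qed
    finally show "(\<Sum>u\<in>V - {v}. of_bool (w \<in> nbhd G u)) = real (card (nbhd G w \<inter> V)) - 1" .
  qed
  finally show ?thesis .
qed

end

section \<open>Supermartingales along the greedy process\<close>

lemma length_greedy_run_le:
  assumes "finite (pverts G)" "vs \<in> set_pmf (greedy_run G i)"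
  shows "length vs \<le> i"
  using assms(2)
proof (induction i arbitrary: vs)
  case (Suc i)
  then obtain us where us: "us \<in> set_pmf (greedy_run G i)" "vs \<in> set_pmf (greedy_step G us)"
    by auto
  then have "length vs \<le> Suc (length us)"
    using assms(1) by (auto simp: greedy_step_def non_nbhd_def split: if_splits)
  then show ?case
    using Suc.IH[OF us(1)] by simp
qed simp

text \<open>Lets events about the first \<open>i\<close> choices of the complete process be measured
  in \<open>greedy_run G i\<close>.\<close>

lemma map_take_greedy_run:
  assumes "finite (pverts G)" "i \<le> j"
  shows "map_pmf (take i) (greedy_run G j) = greedy_run G i"
  using assms(2)
proof (induction j rule: dec_induct)
  case base
  have "map_pmf (take i) (greedy_run G i) = map_pmf (\<lambda>x. x) (greedy_run G i)"
    using length_greedy_run_le[OF assms(1)] by (intro map_pmf_cong) auto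
  then show ?case by simp
next
  case (step j)
  have "map_pmf (take i) (greedy_step G vs) = return_pmf (take i vs)"
    if "vs \<in> set_pmf (greedy_run G j)" for vs
    \<comment> \<open>Either the run has stopped and stays put, or it has length
      \<open>j \<ge> i\<close> and the new vertex lies beyond the prefix.\<close>
    using greedy_run_invariant[OF assms(1) that] step(1)
    by (auto simp: greedy_step_def pmf.map_comp o_def)
  then have "map_pmf (take i) (greedy_run G (Suc j)) =
      bind_pmf (greedy_run G j) (\<lambda>vs. return_pmf (take i vs))"
    by (auto simp: map_bind_pmf intro: bind_pmf_cong)
  also have "\<dots> = greedy_run G i"
    using step.IH by (simp add: map_pmf_def)
  finally show ?case .
qed

lemma nn_integral_greedy_run_le:
  fixes \<Phi> :: "nat \<Rightarrow> 'a list \<Rightarrow> ennreal"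
  assumes "\<And>j vs. j < i \<Longrightarrow> vs \<in> set_pmf (greedy_run G j) \<Longrightarrow>
    (\<integral>\<^sup>+us. \<Phi> (Suc j) us \<partial>greedy_step G vs) \<le> \<Phi> j vs"
  shows "(\<integral>\<^sup>+vs. \<Phi> i vs \<partial>greedy_run G i) \<le> \<Phi> 0 []"
  using assms
proof (induction i)
  case (Suc i)
  have "(\<integral>\<^sup>+vs. \<Phi> (Suc i) vs \<partial>greedy_run G (Suc i)) \<le> (\<integral>\<^sup>+vs. \<Phi> i vs \<partial>greedy_run G i)"
    using Suc.prems by (auto simp: AE_measure_pmf_iff intro!: nn_integral_mono_AE)
  also have "\<dots> \<le> \<Phi> 0 []"
    using Suc by simp
  finally show ?case .
qed simp

section \<open>One step of the process\<close>

lemma exp_le_quadratic: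
  fixes x :: real
  assumes "\<bar>x\<bar> \<le> 1"
  shows "exp x \<le> 1 + x + x\<^sup>2"
proof (cases "x \<ge> 0")
  case True
  then show ?thesis using exp_bound assms by simp
next
  case False
  define y where "y = - x"
  have y: "0 < y" "y \<le> 1" using False assms by (auto simp: y_def)
  \<comment> \<open>The product is \<open>1 + y ^ 3\<close>.\<close>
  have "1 \<le> (1 - y + y\<^sup>2) * (1 + y)"
    using y by (simp add: algebra_simps power2_eq_square)
  also have "\<dots> \<le> (1 - y + y\<^sup>2) * exp y"
    using y by (intro mult_left_mono) auto
  finally have "exp (- y) \<le> 1 - y + y\<^sup>2"
    by (simp add: exp_minus field_simps)
  then show ?thesis by (simp add: y_def)
qed

text \<open>\<open>U\<close> will be the set of choices that keep \<open>v\<close> available.  Choosing a neighbour of \<open>v\<close> kills the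
  potential, but such choices can still be kept in the first moment \<open>A\<close>; only the choice of \<open>v\<close>
  itself, where \<open>c\<close> is a degree instead of a codegree, has to be left out.\<close>

lemma mean_exp_le_one:
  fixes c :: "'a \<Rightarrow> real" and s H C A a :: real
  assumes V: "finite V" "U \<subseteq> V - {v}" "V \<noteq> {}"
    and c: "\<And>u. u \<in> V - {v} \<Longrightarrow> 0 \<le> c u \<and> c u \<le> C"
    and H: "0 \<le> H" "H * C \<le> 1" and s: "\<bar>s\<bar> = 1"
    and A: "A = (\<Sum>u\<in>V - {v}. c u) / real (card V)"
    and a: "- s * A + H * C * A \<le> a"
  shows "(\<Sum>u\<in>U. exp (H * (- s * c u - a))) / real (card V) \<le> 1"
proof -
  define m where "m = real (card V)"
  have m: "m > 0" using V by (simp add: m_def card_gt_0_iff)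
  have sumc: "(\<Sum>u\<in>V - {v}. c u) = m * A" using m by (simp add: A m_def)
  \<comment> \<open>Replacing one factor \<open>H * c u\<close> of the square by its maximum
    \<open>H * C\<close> makes the bound linear in \<open>c u\<close>, so that after summation only
    the mean \<open>A\<close> enters.\<close>
  have quad: "exp (- s * H * c u) \<le> 1 - s * H * c u + H * (H * C) * c u" if "u \<in> V - {v}" for u
  proof -
    have Hc: "0 \<le> H * c u" "H * c u \<le> H * C"
      using c[OF that] H by (auto intro: mult_left_mono)
    then have "\<bar>- s * H * c u\<bar> \<le> 1"
      using s H(2) by (simp add: abs_mult)
    from exp_le_quadratic[OF this]
    have "exp (- s * H * c u) \<le> 1 - s * H * c u + (s * H * c u)\<^sup>2" by simp
    also have "(s * H * c u)\<^sup>2 = (H * c u) * (H * c u)"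
      using s by (simp add: power_mult_distrib power2_eq_square abs_if split: if_splits)
    also have "\<dots> \<le> (H * C) * (H * c u)"
      using Hc by (intro mult_right_mono) auto
    finally show ?thesis by (simp add: algebra_simps)
  qed
  have "(\<Sum>u\<in>U. exp (- s * H * c u)) \<le> (\<Sum>u\<in>V - {v}. exp (- s * H * c u))"
    using V by (intro sum_mono2) auto
  also have "\<dots> \<le> (\<Sum>u\<in>V - {v}. 1 - s * H * c u + H * (H * C) * c u)"
    using quad by (intro sum_mono) auto
  also have "\<dots> = real (card (V - {v})) - s * H * (m * A) + H * (H * C) * (m * A)"
    by (simp add: sum.distrib sum_subtractf sumc sum_distrib_left[symmetric])
  also have "\<dots> \<le> m - s * H * (m * A) + H * (H * C) * (m * A)"
    using V(1) by (simp add: m_def card_mono)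
  also have "\<dots> = m * (1 + H * (- s * A + H * C * A))"
    by (simp add: algebra_simps)
  also have "\<dots> \<le> m * exp (H * a)"
  proof -
    have "H * (- s * A + H * C * A) \<le> H * a" using a H by (intro mult_left_mono) auto
    then have "1 + H * (- s * A + H * C * A) \<le> exp (H * a)"
      using exp_ge_add_one_self[of "H * a"] by linarith
    then show ?thesis using m by simp
  qed
  finally have "(\<Sum>u\<in>U. exp (- s * H * c u)) \<le> m * exp (H * a)" .
  moreover have "(\<Sum>u\<in>U. exp (H * (- s * c u - a))) = (\<Sum>u\<in>U. exp (- s * H * c u)) / exp (H * a)"
    by (simp add: sum_divide_distrib exp_diff[symmetric] algebra_simps)
  ultimately have "(\<Sum>u\<in>U. exp (H * (- s * c u - a))) \<le> m"
    by (simp only: pos_divide_le_eq[OF exp_gt_zero])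
  then show ?thesis
    using m by (simp add: m_def[symmetric])
qed

text \<open>\<open>A\<close> lies within \<open>3 * f * p * X\<close> of \<open>p * X\<close>, and
  \<open>b * A\<close> is at most \<open>4 * f * p * X\<close>. As \<open>X \<le> 2 * D\<close>,
  both together cost at most \<open>14 * p * f * D\<close>, below the available
  \<open>17 * p * f * D\<close>.\<close>

lemma drift_bound:
  fixes p f N D X A m b s :: real
  assumes p: "0 < p" "p \<le> 1 / 100" and f: "0 \<le> f" "f \<le> 1 / 20" and N: "0 < N" and D: "D = p * N"
    and m: "(1 - f) * N \<le> m" "m \<le> (1 + f) * N"
    and X: "(1 - f) * D \<le> X" "X \<le> (1 + f) * D"
    and A: "X * ((1 - f) * D - 1) \<le> m * A" "m * A \<le> X * ((1 + f) * D)"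
    and fD: "1 \<le> f * D" and b: "0 \<le> b" "b \<le> f / (1 - p)" and s: "\<bar>s\<bar> = 1"
  shows "- s * A + b * A \<le> 17 * p * f * D - s * p * X"
proof -
  have D0: "0 < D" using p N D by simp
  have X0: "0 < X" using X(1) mult_pos_pos[of "1 - f" D] D0 f by linarith
  have m0: "0 < m" using m(1) mult_pos_pos[of "1 - f" N] N f by linarith
  \<comment> \<open>The hypothesis \<open>fD\<close> turns the \<open>- 1\<close> into one more
    multiple of \<open>f\<close>.\<close>
  have "X * ((1 - 2 * f) * D) \<le> X * ((1 - f) * D - 1)"
    using X0 fD by (intro mult_left_mono) (auto simp: algebra_simps)
  with A(1) have lo: "X * ((1 - 2 * f) * D) \<le> m * A" by simp
  have "0 \<le> X * ((1 - 2 * f) * D)" using X0 D0 f by simp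
  then have "0 \<le> m * A" using lo by linarith
  then have A0: "0 \<le> A" using m0 by (simp add: zero_le_mult_iff)
  have "m * A \<le> (1 + f) * N * A" using m A0 by (intro mult_right_mono) auto
  with lo have "N * (p * X * (1 - 2 * f)) \<le> N * ((1 + f) * A)"
    by (simp add: D mult_ac)
  then have lo': "p * X * (1 - 2 * f) \<le> (1 + f) * A" using N by simp
  have "(1 - f) * N * A \<le> m * A" using m A0 by (intro mult_right_mono) auto
  with A(2) have "N * ((1 - f) * A) \<le> N * (p * X * (1 + f))"
    by (simp add: D mult_ac)
  then have hi': "(1 - f) * A \<le> p * X * (1 + f)" using N by simp
  define Y where "Y = p * X"
  have Y0: "0 < Y" using p X0 by (simp add: Y_def)
  \<comment> \<open>The constant 3 absorbs the division by \<open>1 + f\<close>, and below by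
    \<open>1 - f\<close>: here \<open>(1 + f) * (1 - 3 * f) = 1 - 2 * f - 3 * f ^ 2\<close>.\<close>
  have "Y * ((1 + f) * (1 - 3 * f)) \<le> Y * (1 - 2 * f)"
    using Y0 f by (intro mult_left_mono) (auto simp: algebra_simps)
  with lo' have "(1 + f) * (Y * (1 - 3 * f)) \<le> (1 + f) * A" by (simp add: Y_def mult_ac)
  then have lo2: "Y * (1 - 3 * f) \<le> A" using f by simp
  have "f * (1 - 3 * f) \<ge> 0" using f by simp
  then have "Y * (1 + f) \<le> Y * ((1 - f) * (1 + 3 * f))"
    using Y0 f by (intro mult_left_mono) (auto simp: algebra_simps)
  with hi' have "(1 - f) * A \<le> (1 - f) * (Y * (1 + 3 * f))" by (simp add: Y_def mult_ac)
  then have hi2: "A \<le> Y * (1 + 3 * f)" using f by simp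
  have "(1 + f) * D \<le> 2 * D" using f D0 by simp
  then have XD: "X \<le> 2 * D" using X by simp
  then have YD: "Y \<le> 2 * (p * D)" using p by (simp add: Y_def)
  have "s * (Y - A) \<le> \<bar>s * (Y - A)\<bar>" by simp
  also have "\<dots> = \<bar>Y - A\<bar>" using s by (simp add: abs_mult)
  also have "\<dots> \<le> 3 * f * Y" using lo2 hi2 by (simp add: algebra_simps abs_le_iff)
  finally have 1: "s * (Y - A) \<le> 3 * f * Y" .
  have "f / (1 - p) \<le> 2 * f" using p f by (simp add: field_simps mult_left_le)
  then have "b * A \<le> 2 * f * A" using b A0 by (intro mult_right_mono) auto
  also have "\<dots> \<le> 2 * f * (2 * Y)"
  proof -
    have "Y * (1 + 3 * f) \<le> Y * 2" using Y0 f by (intro mult_left_mono) auto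
    with hi2 show ?thesis using f by (intro mult_left_mono) auto
  qed
  finally have 2: "b * A \<le> 4 * f * Y" by simp
  have "7 * f * Y \<le> 7 * f * (2 * (p * D))" using YD f by (intro mult_left_mono) auto
  also have "\<dots> \<le> 17 * p * f * D" using p f D0 by (simp add: mult_ac)
  finally show ?thesis using 1 2 by (simp add: Y_def algebra_simps)
qed


section \<open>The exponential potential\<close>

lemma f_err_Suc: "f_err n p (Suc i) = (1 + 16 * p) / (1 - p) * f_err n p i"
  by (simp add: f_err_def)

text \<open>The regime of large \<open>n\<close> is reduced to numerical conditions on one graph:
  the horizon \<open>k\<close> stays inside the range of (P1) and is short enough for the windows to
  remain narrow.\<close>

locale typical_process = pair_graph G for G :: "'a pair_pre_digraph" +
  fixes \<epsilon> p k :: real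
  assumes typical: "typical \<epsilon> p G"
    and eps_le: "\<epsilon> \<le> 1"
    and p_pos: "0 < p" and p_le: "p \<le> 1 / 100"
    and ln_pn_ge: "1 \<le> ln (p * real (card (pverts G)))"
    and k_le: "k \<le> \<epsilon> * inverse p * ln (p * real (card (pverts G)))"
    and f_err_le: "\<And>i. real i \<le> k \<Longrightarrow> f_err (card (pverts G)) p i \<le> 1 / 20"
begin

abbreviation n :: nat where "n \<equiv> card (pverts G)"
abbreviation f :: "nat \<Rightarrow> real" where "f \<equiv> f_err n p"

definition codeg_bound :: real where
  "codeg_bound = 4 * p\<^sup>2 * real n + 2 ^ 7 * ln (real n)"

text \<open>Since \<open>h * codeg_bound = f 0\<close>, the second-order factor at time
  \<open>j\<close> is, after rescaling, at most \<open>f j / (1 - p)\<close>, the scale of the drift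
  error, while \<open>h * f 0 * p * n\<close> stays large enough for the tail bound.\<close>

definition h :: real where
  "h = f 0 / codeg_bound"

definition good :: "nat \<Rightarrow> 'a list \<Rightarrow> bool" where
  "good i vs \<longleftrightarrow> (\<forall>v \<in> avail G vs i. real (degree_in G (avail G vs i) v) \<in>
    {(1 - f i) * d_tilde n p i .. (1 + f i) * d_tilde n p i})"

text \<open>The sign \<open>s\<close> is \<open>1\<close> for the upper and \<open>-1\<close> for the lower bound on the degree.  The potential
  is killed as soon as \<open>v\<close> becomes unavailable or some degree has left its window.\<close>

definition potential :: "real \<Rightarrow> 'a \<Rightarrow> nat \<Rightarrow> 'a list \<Rightarrow> real" where
  "potential s v i vs =
    (if v \<in> avail G vs i \<and> (\<forall>j<i. good j vs)
     then exp (h * s * (real (card (nbhd G v \<inter> avail G vs i)) / (1 - p) ^ i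
       - (1 + s * f i) * (p * real n)))
     else 0)"

section \<open>Numerical consequences of the assumptions\<close>

lemma pn_gt_one: "1 < p * real n"
proof (rule ccontr)
  assume asm: "\<not> 1 < p * real n"
  define x where "x = p * real n"
  have "0 \<le> x" "x \<le> 1" using asm p_pos by (auto simp: x_def)
  \<comment> \<open>At \<open>x = 0\<close> the default value \<open>ln 0 = 0\<close> is
    used.\<close>
  then have "ln x \<le> 0" by (cases "x = 0") auto
  with ln_pn_ge show False by (simp add: x_def)
qed

lemma n_pos: "0 < n"
  using pn_gt_one by (cases "n = 0") auto

lemma ln_pn_le: "ln (p * real n) \<le> ln (real n)"
proof -
  have "p * real n \<le> 1 * real n" using p_le by (intro mult_right_mono) auto
  then show ?thesis using pn_gt_one n_pos by simp
qed

lemma ln_n_ge: "1 \<le> ln (real n)"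
  using ln_pn_le ln_pn_ge by simp

text \<open>Follows from \<open>ln x \<le> x\<close>. Hence the union bound has at most
  \<open>n + 1\<close> times, all covered by \<open>greedy_run G n\<close>.\<close>

lemma k_le_n: "k \<le> real n"
proof (cases "0 \<le> \<epsilon>")
  case True
  have "k \<le> 1 * inverse p * ln (p * real n)"
    using k_le eps_le p_pos ln_pn_ge
    by (elim order_trans, intro mult_right_mono) auto
  also have "ln (p * real n) \<le> p * real n"
    using pn_gt_one ln_less_self[of "p * real n"] by linarith
  then have "1 * inverse p * ln (p * real n) \<le> 1 * inverse p * (p * real n)"
    using p_pos by (intro mult_left_mono) auto
  finally show ?thesis using p_pos by (simp add: field_simps)
next
  case False
  then have "\<epsilon> * (inverse p * ln (p * real n)) \<le> 0"
    using p_pos ln_pn_ge by (intro mult_nonpos_nonneg) auto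
  then show ?thesis using k_le by (simp add: mult.assoc)
qed

lemma codeg_bound_pos: "0 < codeg_bound"
  using p_pos ln_n_ge by (auto simp: codeg_bound_def intro!: add_nonneg_pos)

lemma f0_eq: "f 0 = 4 * ln (real n) * sqrt (ln (p * real n) / (p * real n) + p)"
  by (simp add: f_err_def)

lemma f0_pos: "0 < f 0"
  using ln_n_ge ln_pn_ge pn_gt_one p_pos by (simp add: f0_eq add_nonneg_pos)

lemma f_pos: "0 < f i"
  using f0_pos p_pos p_le by (simp add: f_err_def)

text \<open>The denominator of the growth factor cancels \<open>(1 - p) ^ i\<close>, leaving
  \<open>f 0 * (1 + 16 * p) ^ i\<close>: in absolute terms the windows never become narrower than at
  time 0.\<close>

lemma f0_le: "f 0 \<le> f i * (1 - p) ^ i"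
proof -
  have "f 0 * 1 \<le> f 0 * (1 + 16 * p) ^ i"
    using f0_pos p_pos by (intro mult_left_mono one_le_power) auto
  also have "\<dots> = f i * (1 - p) ^ i"
    using p_le by (simp add: f_err_def power_divide)
  finally show ?thesis by simp
qed

text \<open>Rests on \<open>1 / x \<le> sqrt (1 / x)\<close> for \<open>x \<ge> 1\<close>. A window
  at least one vertex wide absorbs the \<open>- 1\<close> of \<open>sum_codegree\<close>.\<close>

lemma f0_pn_ge: "1 \<le> f 0 * (p * real n)"
proof -
  define x where "x = p * real n"
  have x: "1 < x" "1 \<le> ln x" using pn_gt_one ln_pn_ge by (auto simp: x_def)
  have "1 / x \<le> sqrt (1 / x)"
    using x by (intro real_le_rsqrt) (simp add: power2_eq_square field_simps)
  also have "\<dots> \<le> sqrt (ln x / x + p)"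
    using x p_pos by (simp add: add_increasing2 divide_right_mono)
  also have "\<dots> = 1 * sqrt (ln x / x + p)"
    by simp
  also have "\<dots> \<le> 4 * ln (real n) * sqrt (ln x / x + p)"
    using ln_n_ge x p_pos by (intro mult_right_mono) auto
  finally show ?thesis
    using x by (simp add: f0_eq x_def[symmetric] field_simps)
qed

lemma h_pos: "0 < h"
  using f0_pos codeg_bound_pos by (simp add: h_def)

section \<open>Typicality as separate inequalities\<close>

lemma codegree_le:
  assumes "u \<in> pverts G" "v \<in> pverts G" "u \<noteq> v"
  shows "real (card (nbhd G u \<inter> nbhd G v)) \<le> codeg_bound"
  using typical assms by (auto simp: typical_def Let_def codeg_bound_def)

lemma degree_bounds:
  assumes "v \<in> pverts G"
  shows "(1 - f 0 / 2) * (p * real n) \<le> real (card (nbhd G v))"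
    and "real (card (nbhd G v)) \<le> (1 + f 0 / 2) * (p * real n)"
  using typical assms by (auto simp: typical_def Let_def out_degree_eq_card_nbhd)

lemma card_non_nbhd_bounds:
  assumes "S \<subseteq> pverts G" "card S = j" "real j \<le> k"
  shows "(1 - f j) * ((1 - p) ^ j * real n) \<le> real (card (non_nbhd G S))"
    and "real (card (non_nbhd G S)) \<le> (1 + f j) * ((1 - p) ^ j * real n)"
  using typical assms k_le by (auto simp: typical_def Let_def)

text \<open>The drift has two sources: the extra factor \<open>1 / (1 - p)\<close> contributes
  \<open>s * p * X\<close>, and the widening of the window contributes
  \<open>- 17 * p * f j * d_tilde n p j\<close>.\<close>

lemma potential_increment:
  fixes X c s :: real
  assumes s: "\<bar>s\<bar> = 1"
  shows "h * s * ((X - c) / (1 - p) ^ Suc j - (1 + s * f (Suc j)) * (p * real n)) =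
    h * s * (X / (1 - p) ^ j - (1 + s * f j) * (p * real n)) +
    h / (1 - p) ^ Suc j * (- s * c - (17 * p * f j * d_tilde n p j - s * p * X))"
proof -
  define q where "q = 1 - p"
  have q: "q > 0" using p_le by (simp add: q_def)
  have ss: "s * s = 1" using s by (auto simp: abs_if split: if_splits)
  \<comment> \<open>The 17 arises from
    \<open>(1 + 16 * p) / (1 - p) = 1 + 17 * p / (1 - p)\<close>.\<close>
  have "f (Suc j) = f j + 17 * p / q * f j"
    using q by (simp add: f_err_Suc q_def[symmetric] field_simps) (simp add: q_def algebra_simps)
  then have "h * s * ((X - c) / q ^ Suc j - (1 + s * f (Suc j)) * (p * real n)) =
      h * s * ((X - c) / q ^ Suc j) - h * s * (1 + s * f j) * (p * real n)
        - h * (s * s) * (17 * p / q * f j) * (p * real n)"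
    by (simp add: algebra_simps)
  moreover have "h * s * ((X - c) / q ^ Suc j) =
      h * s * (X / q ^ j) + h / q ^ Suc j * (- s * c + s * p * X)"
    using q by (simp add: field_simps) (simp add: q_def algebra_simps)
  moreover have "h * (17 * p / q * f j) * (p * real n) =
      h / q ^ Suc j * (17 * p * f j * (q ^ j * p * real n))"
    using q by (simp add: field_simps)
  moreover define H where "H = h / q ^ Suc j"
  ultimately have "h * s * ((X - c) / q ^ Suc j - (1 + s * f (Suc j)) * (p * real n)) =
      h * s * (X / q ^ j) + H * (- s * c + s * p * X) - h * s * (1 + s * f j) * (p * real n)
        - H * (17 * p * f j * (q ^ j * p * real n))"
    by (simp add: ss)
  then show ?thesis
    unfolding q_def[symmetric] d_tilde_def H_def[symmetric] by (simp add: algebra_simps)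
qed

section \<open>The supermartingale property\<close>

lemma good_cong: "take i us = take i vs \<Longrightarrow> good i us \<longleftrightarrow> good i vs"
  by (simp add: good_def avail_def)

text \<open>On a live state a choice \<open>u\<close> multiplies the potential by
  \<open>exp (H * (- s * c u - a))\<close> if \<open>v\<close> survives and by 0 otherwise. The
  claim thus reduces to \<open>mean_exp_le_one\<close>, whose drift condition is
  \<open>drift_bound\<close>.\<close>

lemma potential_supermartingale:
  assumes s: "\<bar>s\<bar> = 1" and j: "real j \<le> k" and vs: "vs \<in> set_pmf (greedy_run G j)"
  shows "(\<integral>\<^sup>+us. ennreal (potential s v (Suc j) us) \<partial>greedy_step G vs) \<le> ennreal (potential s v j vs)"
proof -
  define V where "V = non_nbhd G (set vs)"
  have fin: "finite V" by (simp add: V_def finite_non_nbhd)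
  note inv = greedy_run_invariant[OF pair_finite_verts vs] length_greedy_run_le[OF pair_finite_verts vs]
  consider "V = {}" | "V \<noteq> {}" "\<not> (v \<in> V \<and> (\<forall>i\<le>j. good i vs))"
    | "V \<noteq> {}" "v \<in> V" "\<forall>i\<le>j. good i vs" by blast
  then show ?thesis
  proof cases
    \<comment> \<open>The stopped list has length at most \<open>j\<close>, so nothing is available
      at time \<open>Suc j\<close> either.\<close>
    case 1
    then have "potential s v (Suc j) vs = 0"
      using inv(2) by (simp add: potential_def avail_def V_def)
    then show ?thesis using 1 by (simp add: greedy_step_def V_def)
  next
    \<comment> \<open>At time \<open>Suc j\<close> the window at time \<open>j\<close> itself is
      also tested, so an exit at time \<open>j\<close> kills the potential one step later.\<close>
    case 2
    have len: "length vs = j" using inv(1) 2(1) by (simp add: V_def)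
    have "potential s v (Suc j) (vs @ [u]) = 0" for u
    proof -
      have "avail G (vs @ [u]) (Suc j) \<subseteq> V"
        using len by (auto simp: avail_def non_nbhd_def V_def)
      moreover have "good i (vs @ [u]) \<longleftrightarrow> good i vs" if "i \<le> j" for i
        using that len by (intro good_cong) simp
      ultimately show ?thesis using 2(2) by (auto simp: potential_def less_Suc_eq_le)
    qed
    then show ?thesis using 2(1) by (simp add: greedy_step_def V_def)
  next
    case 3
    have len: "length vs = j" using inv(1) 3(1) by (simp add: V_def)
    have VG: "V \<subseteq> pverts G" by (auto simp: V_def non_nbhd_def)
    have availj: "avail G vs j = V" using len by (simp add: avail_def V_def)
    define U where "U = {u \<in> V. v \<in> non_nbhd G (insert u (set vs))}"
    define X where "X = real (card (nbhd G v \<inter> V))"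
    define c where "c u = real (card (nbhd G u \<inter> nbhd G v \<inter> V))" for u
    define D where "D = d_tilde n p j"
    define m where "m = real (card V)"
    define H where "H = h / (1 - p) ^ Suc j"
    define a where "a = 17 * p * f j * D - s * p * X"
    define A where "A = (\<Sum>u\<in>V - {v}. c u) / m"
    have m0: "0 < m" using 3(1) fin by (simp add: m_def card_gt_0_iff)
    have U: "U \<subseteq> V - {v}" by (auto simp: U_def non_nbhd_insert)
    have H0: "0 \<le> H" using h_pos p_le by (simp add: H_def)
    have c: "0 \<le> c u \<and> c u \<le> codeg_bound" if "u \<in> V - {v}" for u
    proof -
      have "c u \<le> real (card (nbhd G u \<inter> nbhd G v))"
        by (auto simp: c_def finite_nbhd intro!: card_mono)
      also have "\<dots> \<le> codeg_bound" using that 3(2) VG by (intro codegree_le) auto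
      finally show ?thesis by (simp add: c_def)
    qed
    have "H * codeg_bound = f 0 / (1 - p) ^ j / (1 - p)"
      using codeg_bound_pos by (simp add: H_def h_def)
    also have "\<dots> \<le> f j / (1 - p)"
      using f0_le[of j] p_le by (intro divide_right_mono) (auto simp: divide_le_eq)
    finally have HC: "H * codeg_bound \<le> f j / (1 - p)" .
    have "f j / (1 - p) \<le> 1" using f_err_le[OF j] p_le by simp
    with HC have HC1: "H * codeg_bound \<le> 1" by simp
    have deg: "(1 - f j) * D \<le> real (card (nbhd G w \<inter> V))"
      "real (card (nbhd G w \<inter> V)) \<le> (1 + f j) * D" if "w \<in> V" for w
      using 3(3) that by (auto simp: good_def availj D_def degree_in_eq_card)
    have sumA: "m * A = (\<Sum>w\<in>nbhd G v \<inter> V. real (card (nbhd G w \<inter> V)) - 1)"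
      using m0 sum_codegree[OF fin 3(2)] by (simp add: A_def c_def)
    \<comment> \<open>The parameter \<open>N\<close> below is the predicted size of
      \<open>V\<close>, for which (P1) supplies the relative error \<open>f j\<close>.\<close>
    have "- s * A + H * codeg_bound * A \<le> a"
      unfolding a_def
    proof (rule drift_bound[where m = m and N = "(1 - p) ^ j * real n"])
      show "0 < p" "p \<le> 1 / 100" "0 \<le> f j" "f j \<le> 1 / 20" "\<bar>s\<bar> = 1"
        using p_pos p_le f_pos[of j] f_err_le[OF j] s by auto
      show "0 < (1 - p) ^ j * real n" using p_le n_pos by simp
      show "D = p * ((1 - p) ^ j * real n)" by (simp add: D_def d_tilde_def)
      show "(1 - f j) * ((1 - p) ^ j * real n) \<le> m" "m \<le> (1 + f j) * ((1 - p) ^ j * real n)"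
        using card_non_nbhd_bounds[of "set vs" j] inv(1) len j
        by (auto simp: m_def V_def distinct_card)
      show "(1 - f j) * D \<le> X" "X \<le> (1 + f j) * D" using deg[OF 3(2)] by (auto simp: X_def)
      show "X * ((1 - f j) * D - 1) \<le> m * A"
        unfolding sumA X_def using deg by (intro sum_bounded_below) auto
      have "m * A \<le> X * ((1 + f j) * D)"
        unfolding sumA X_def
      proof (rule sum_bounded_above)
        fix w assume "w \<in> nbhd G v \<inter> V"
        then show "real (card (nbhd G w \<inter> V)) - 1 \<le> (1 + f j) * D" using deg(2)[of w] by simp
      qed
      then show "m * A \<le> X * ((1 + f j) * D)" .
      have "1 \<le> f 0 * (p * real n)" by (rule f0_pn_ge)
      also have "\<dots> \<le> f j * (1 - p) ^ j * (p * real n)"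
        using f0_le p_pos by (intro mult_right_mono) auto
      finally show "1 \<le> f j * D" by (simp add: D_def d_tilde_def mult_ac)
      show "0 \<le> H * codeg_bound" using H0 codeg_bound_pos by simp
      show "H * codeg_bound \<le> f j / (1 - p)" by (rule HC)
    qed
    then have mean: "(\<Sum>u\<in>U. exp (H * (- s * c u - a))) / m \<le> 1"
      using mean_exp_le_one[OF fin U 3(1) c H0 HC1 s] by (simp add: A_def m_def)
    have pot: "potential s v (Suc j) (vs @ [u]) =
        (if u \<in> U then potential s v j vs * exp (H * (- s * c u - a)) else 0)" if "u \<in> V" for u
    proof -
      have av: "avail G (vs @ [u]) (Suc j) = non_nbhd G (insert u (set vs))"
        using len by (simp add: avail_def)
      have g: "good i (vs @ [u])" if "i < Suc j" for i
      proof -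
        have "good i (vs @ [u]) \<longleftrightarrow> good i vs" using that len by (intro good_cong) simp
        then show ?thesis using 3(3) that by simp
      qed
      show ?thesis
      proof (cases "u \<in> U")
        case False
        then show ?thesis using that by (simp add: potential_def av U_def)
      next
        case True
        then have vu: "v \<in> non_nbhd G (insert u (set vs))" by (simp add: U_def)
        have "real (card (nbhd G v \<inter> non_nbhd G (insert u (set vs)))) = X - c u"
          using card_nbhd_non_nbhd_insert[OF vu] by (simp add: X_def c_def V_def)
        then have "potential s v (Suc j) (vs @ [u]) =
            exp (h * s * ((X - c u) / (1 - p) ^ Suc j - (1 + s * f (Suc j)) * (p * real n)))"
          using vu g by (simp add: potential_def av)
        moreover have "potential s v j vs = exp (h * s * (X / (1 - p) ^ j - (1 + s * f j) * (p * real n)))"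
          using 3 by (simp add: potential_def availj X_def)
        ultimately show ?thesis
          using True by (simp only: potential_increment[OF s] exp_add H_def a_def D_def if_True)
      qed
    qed
    have "(\<integral>\<^sup>+us. ennreal (potential s v (Suc j) us) \<partial>greedy_step G vs) =
        (\<Sum>u\<in>V. ennreal (potential s v (Suc j) (vs @ [u]))) / real (card V)"
      using 3(1) fin by (simp add: greedy_step_def V_def nn_integral_pmf_of_set ennreal_of_nat_eq_real_of_nat)
    also have "(\<Sum>u\<in>V. ennreal (potential s v (Suc j) (vs @ [u]))) =
        ennreal (\<Sum>u\<in>V. potential s v (Suc j) (vs @ [u]))"
      by (rule sum_ennreal) (simp add: potential_def)
    also have "\<dots> / real (card V) = ennreal ((\<Sum>u\<in>V. potential s v (Suc j) (vs @ [u])) / m)"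
      using m0 by (subst divide_ennreal[symmetric])
        (auto simp: m_def potential_def ennreal_of_nat_eq_real_of_nat intro!: sum_nonneg)
    also have "(\<Sum>u\<in>V. potential s v (Suc j) (vs @ [u])) / m =
        potential s v j vs * ((\<Sum>u\<in>U. exp (H * (- s * c u - a))) / m)"
    proof -
      have "(\<Sum>u\<in>V. potential s v (Suc j) (vs @ [u])) =
          (\<Sum>u\<in>V. if u \<in> U then potential s v j vs * exp (H * (- s * c u - a)) else 0)"
        using pot by (intro sum.cong) auto
      also have "\<dots> = (\<Sum>u\<in>U. potential s v j vs * exp (H * (- s * c u - a)))"
        using fin U by (subst sum.inter_restrict[symmetric])
          (auto simp: Int_absorb1 subset_eq intro!: sum.cong)
      finally show ?thesis by (simp add: sum_distrib_left)
    qed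
    also have "\<dots> \<le> potential s v j vs * 1"
      by (intro mult_left_mono mean) (simp add: potential_def)
    finally show ?thesis by (simp add: ennreal_leI)
  qed
qed


text \<open>(P2) allows only half of the window width, so the initial degree is at least
  \<open>f 0 * (p * n) / 2\<close> away from either end.\<close>

lemma potential_initial_le:
  assumes s: "\<bar>s\<bar> = 1"
  shows "potential s v 0 [] \<le> exp (- (h * f 0 * (p * real n) / 2))"
proof (cases "v \<in> pverts G")
  case True
  define d where "d = real (card (nbhd G v))"
  have av: "avail G [] 0 = pverts G" by (simp add: avail_def non_nbhd_def)
  have "nbhd G v \<inter> pverts G = nbhd G v" using nbhd_subset by blast
  then have "potential s v 0 [] = exp (h * s * (d - (1 + s * f 0) * (p * real n)))"
    using True by (simp add: potential_def av d_def)
  also have "h * s * (d - (1 + s * f 0) * (p * real n)) = h * (s * (d - (1 + s * f 0) * (p * real n)))"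
    by simp
  also have "\<dots> \<le> h * (- (f 0 * (p * real n) / 2))"
    using degree_bounds[OF True] s h_pos
    by (intro mult_left_mono) (auto simp: d_def abs_if algebra_simps split: if_splits)
  finally show ?thesis by (simp add: mult.assoc)
next
  case False
  then show ?thesis by (simp add: potential_def avail_def non_nbhd_def)
qed

section \<open>First exit from the windows and the union bound\<close>

definition first_failure :: "real \<Rightarrow> 'a \<Rightarrow> nat \<Rightarrow> 'a list set" where
  "first_failure s v i = {vs. v \<in> avail G vs i \<and> (\<forall>j<i. good j vs) \<and>
    s * (real (degree_in G (avail G vs i) v) - (1 + s * f i) * d_tilde n p i) > 0}"

text \<open>Markov's inequality: windows are required only strictly before \<open>i\<close>, so the
  potential is still alive when \<open>v\<close> exits at time \<open>i\<close>, and there it is at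
  least 1.\<close>

lemma first_failure_prob:
  assumes s: "\<bar>s\<bar> = 1" and i: "real i \<le> k"
  shows "measure_pmf.prob (greedy_run G i) (first_failure s v i) \<le> exp (- (h * f 0 * (p * real n) / 2))"
proof -
  have "1 \<le> potential s v i vs" if "vs \<in> first_failure s v i" for vs
  proof -
    define X where "X = real (card (nbhd G v \<inter> avail G vs i))"
    from that have v: "v \<in> avail G vs i" "\<forall>j<i. good j vs"
      and X: "s * (X - (1 + s * f i) * d_tilde n p i) > 0"
      by (auto simp: first_failure_def X_def degree_in_eq_card)
    have q: "0 < (1 - p) ^ i" using p_le by simp
    have "X / (1 - p) ^ i - (1 + s * f i) * (p * real n) =
        (X - (1 + s * f i) * d_tilde n p i) / (1 - p) ^ i"
      using p_le by (simp add: d_tilde_def field_simps)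
    then have "h * s * (X / (1 - p) ^ i - (1 + s * f i) * (p * real n)) =
        h * (s * (X - (1 + s * f i) * d_tilde n p i) / (1 - p) ^ i)"
      by simp
    also have "\<dots> \<ge> 0"
      using divide_pos_pos[OF X q] h_pos by (intro mult_nonneg_nonneg) linarith+
    finally show ?thesis using v by (simp add: potential_def X_def)
  qed
  then have "emeasure (greedy_run G i) (first_failure s v i) \<le>
      (\<integral>\<^sup>+vs. ennreal (potential s v i vs) \<partial>greedy_run G i)"
    by (subst nn_integral_indicator[symmetric], simp, intro nn_integral_mono)
      (auto simp: indicator_def)
  also have "\<dots> \<le> ennreal (potential s v 0 [])"
    using s i by (intro nn_integral_greedy_run_le potential_supermartingale) auto
  also have "\<dots> \<le> ennreal (exp (- (h * f 0 * (p * real n) / 2)))"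
    by (intro ennreal_leI potential_initial_le s)
  finally show ?thesis
    by (simp add: measure_pmf.emeasure_eq_measure)
qed

text \<open>Take the least bad time \<open>j\<close>; the sign records the side of the exit.
  Truncation is harmless because windows up to time \<open>j\<close> depend only on the first
  \<open>j\<close> choices.\<close>

lemma not_good_first_failure:
  assumes "\<not> good i vs"
  obtains j v s where "j \<le> i" "v \<in> pverts G" "s \<in> {1, -1}" "take j vs \<in> first_failure s v j"
proof -
  define j where "j = (LEAST j. \<not> good j vs)"
  have j: "\<not> good j vs" "j \<le> i" "\<forall>j'<j. good j' vs"
    unfolding j_def using assms LeastI[of "\<lambda>j. \<not> good j vs", OF assms]
    by (auto intro: Least_le dest: not_less_Least)
  from j(1) obtain v where v: "v \<in> avail G vs j" and
    out: "real (degree_in G (avail G vs j) v) \<notin> {(1 - f j) * d_tilde n p j .. (1 + f j) * d_tilde n p j}"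
    by (auto simp: good_def)
  obtain s :: real where s: "s \<in> {1, -1}"
    "s * (real (degree_in G (avail G vs j) v) - (1 + s * f j) * d_tilde n p j) > 0"
  proof (cases "real (degree_in G (avail G vs j) v) > (1 + f j) * d_tilde n p j")
    case True
    then show ?thesis using that[of 1] by simp
  next
    case False
    with out have "real (degree_in G (avail G vs j) v) < (1 - f j) * d_tilde n p j" by auto
    then show ?thesis using that[of "-1"] by simp
  qed
  have "good j' (take j vs)" if "j' < j" for j'
    using j(3) that good_cong[of j' "take j vs" vs] by (simp add: min_def)
  moreover have "avail G (take j vs) j = avail G vs j"
    by (simp add: avail_def)
  ultimately have "take j vs \<in> first_failure s v j"
    using v s by (simp add: first_failure_def)
  moreover have "v \<in> pverts G" using v by (auto simp: avail_def non_nbhd_def)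
  ultimately show ?thesis using that j(2) s(1) by blast
qed

text \<open>The two terms under the root of \<open>f 0\<close> match the two terms of
  \<open>codeg_bound\<close>: the exponent is
  \<open>8 * L ^ 2 * (y + P) / (4 * P + 128 * L)\<close>, which is of order at least
  \<open>L * y\<close> whichever term of the denominator dominates.\<close>

lemma exponent_ge: "ln (real n) * ln (p * real n) / 16 \<le> h * f 0 * (p * real n) / 2"
proof -
  define L where "L = ln (real n)"
  define y where "y = ln (p * real n)"
  define P where "P = p\<^sup>2 * real n"
  have L: "1 \<le> y" "y \<le> L" using ln_pn_ge ln_pn_le by (auto simp: L_def y_def)
  have P: "0 \<le> P" by (simp add: P_def)
  have "f 0 * f 0 = 16 * L\<^sup>2 * (y / (p * real n) + p)"
    using L pn_gt_one p_pos by (simp add: f0_eq L_def[symmetric] y_def[symmetric] power2_eq_square)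
  then have "f 0 * f 0 * (p * real n) =
      16 * L\<^sup>2 * (y / (p * real n) * (p * real n) + p * (p * real n))"
    by (simp add: algebra_simps)
  also have "\<dots> = 16 * L\<^sup>2 * (y + P)"
  proof -
    have "p * real n \<noteq> 0" using pn_gt_one by linarith
    then have "y / (p * real n) * (p * real n) = y" by (metis nonzero_divide_eq_eq)
    then show ?thesis by (simp add: P_def power2_eq_square)
  qed
  finally have f0_sq: "f 0 * f 0 * (p * real n) = 16 * L\<^sup>2 * (y + P)" .
  have "h * f 0 * (p * real n) / 2 = 8 * L\<^sup>2 * (y + P) / (4 * P + 128 * L)"
  proof -
    have "h * f 0 * (p * real n) / 2 = f 0 * f 0 * (p * real n) / codeg_bound / 2"
      by (simp add: h_def)
    also have "\<dots> = 16 * L\<^sup>2 * (y + P) / codeg_bound / 2"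
      by (simp only: f0_sq)
    also have "\<dots> = 8 * L\<^sup>2 * (y + P) / codeg_bound" by simp
    also have "codeg_bound = 4 * P + 128 * L" by (simp add: codeg_bound_def L_def P_def)
    finally show ?thesis .
  qed
  \<comment> \<open>After cancelling \<open>128 * L ^ 2 * y\<close> there remains
    \<open>4 * L * y * P \<le> 128 * L ^ 2 * P\<close>, a consequence of
    \<open>y \<le> L\<close>.\<close>
  moreover have "L * y * (4 * P + 128 * L) \<le> 128 * L\<^sup>2 * (y + P)"
  proof -
    have "4 * y * (L * P) \<le> 128 * L * (L * P)"
      using L P by (intro mult_right_mono) auto
    then show ?thesis by (simp add: algebra_simps power2_eq_square)
  qed
  moreover have "0 < 4 * P + 128 * L" using L P by simp
  ultimately have "L * y / 16 \<le> h * f 0 * (p * real n) / 2"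
    by (simp only: pos_le_divide_eq) simp
  then show ?thesis by (simp add: L_def y_def)
qed

text \<open>Union bound over at most \<open>n + 1\<close> times, \<open>n\<close> vertices and two
  signs, with \<open>(n + 1) * (2 * n) \<le> 4 * n ^ 2\<close>.\<close>

lemma all_good_prob:
  "measure_pmf.prob (greedy_process G) {vs. \<forall>i. real i \<le> k \<longrightarrow> good i vs} \<ge>
    1 - 4 * (real n)\<^sup>2 * exp (- (ln (real n) * ln (p * real n) / 16))"
proof -
  define I where "I = {i. i \<le> n \<and> real i \<le> k} \<times> pverts G \<times> {1, -1 :: real}"
  define bad where "bad = {vs. \<exists>i. real i \<le> k \<and> \<not> good i vs}"
  define \<delta> where "\<delta> = exp (- (ln (real n) * ln (p * real n) / 16))"
  let ?M = "measure_pmf (greedy_process G)"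
  have fin: "finite I" unfolding I_def using pair_finite_verts by auto
  have "card {i. i \<le> n \<and> real i \<le> k} \<le> card {..n}" by (intro card_mono) auto
  then have "real (card {i. i \<le> n \<and> real i \<le> k}) \<le> real (n + 1)" by simp
  then have "real (card I) \<le> real (n + 1) * (real n * 2)"
    unfolding I_def by (simp add: card_cartesian_product mult_right_mono)
  also have "\<dots> \<le> 4 * (real n)\<^sup>2"
    using n_pos by (simp add: power2_eq_square algebra_simps)
  finally have cardI: "real (card I) \<le> 4 * (real n)\<^sup>2" .
  have "bad \<subseteq> (\<Union>(i, v, s)\<in>I. take i -` first_failure s v i)"
  proof
    fix vs assume "vs \<in> bad"
    then obtain i where i: "real i \<le> k" "\<not> good i vs" by (auto simp: bad_def)
    from not_good_first_failure[OF i(2)] obtain j v s where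
      *: "j \<le> i" "v \<in> pverts G" "s \<in> {1, -1}" "take j vs \<in> first_failure s v j" .
    moreover from this(1) have "real j \<le> k" "j \<le> n" using i(1) k_le_n by linarith+
    ultimately show "vs \<in> (\<Union>(i, v, s)\<in>I. take i -` first_failure s v i)"
      by (auto simp: I_def)
  qed
  then have "measure ?M bad \<le> measure ?M (\<Union>(i, v, s)\<in>I. take i -` first_failure s v i)"
    by (intro measure_pmf.finite_measure_mono) auto
  also have "\<dots> \<le> (\<Sum>(i, v, s)\<in>I. measure ?M (take i -` first_failure s v i))"
    using measure_pmf.finite_measure_subadditive_finite[OF fin,
      of "\<lambda>(i, v, s). take i -` first_failure s v i" "greedy_process G"]
    by (simp add: case_prod_unfold)
  also have "\<dots> \<le> (\<Sum>(i, v, s)\<in>I. \<delta>)"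
  proof (rule sum_mono, clarify)
    fix i v s assume "(i, v, s) \<in> I"
    then have i: "i \<le> n" "real i \<le> k" "\<bar>s\<bar> = 1" by (auto simp: I_def)
    have "measure ?M (take i -` first_failure s v i) =
        measure_pmf.prob (map_pmf (take i) (greedy_process G)) (first_failure s v i)"
      by simp
    also have "\<dots> = measure_pmf.prob (greedy_run G i) (first_failure s v i)"
      using i by (simp only: greedy_process_def map_take_greedy_run[OF pair_finite_verts])
    also have "\<dots> \<le> exp (- (h * f 0 * (p * real n) / 2))"
      using i by (intro first_failure_prob)
    also have "\<dots> \<le> \<delta>" using exponent_ge by (simp add: \<delta>_def)
    finally show "measure ?M (take i -` first_failure s v i) \<le> \<delta>" .
  qed
  also have "\<dots> = real (card I) * \<delta>" by (simp add: case_prod_unfold)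
  also have "\<dots> \<le> 4 * (real n)\<^sup>2 * \<delta>"
    using cardI by (intro mult_right_mono) (auto simp: \<delta>_def)
  finally have "measure ?M bad \<le> 4 * (real n)\<^sup>2 * \<delta>" .
  moreover have "{vs. \<forall>i. real i \<le> k \<longrightarrow> good i vs} = - bad"
    by (auto simp: bad_def)
  moreover have "measure ?M (- bad) = 1 - measure ?M bad"
    using measure_pmf.prob_compl[of bad "greedy_process G"] by (simp add: Compl_eq_Diff_UNIV)
  ultimately show ?thesis by (simp add: \<delta>_def)
qed

end

section \<open>Asymptotics\<close>

text \<open>\<open>(1 + 18 * p) * (1 - p)\<close> exceeds \<open>1 + 16 * p\<close> by
  \<open>p * (1 - 18 * p)\<close>.\<close>

lemma growth_factor_power_le:
  fixes p :: real
  assumes "0 < p" "p \<le> 1 / 100"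
  shows "((1 + 16 * p) / (1 - p)) ^ i \<le> exp (18 * p * real i)"
proof -
  have "(1 + 16 * p) / (1 - p) \<le> 1 + 18 * p"
    using assms by (simp add: field_simps)
  also have "\<dots> \<le> exp (18 * p)" by (rule exp_ge_add_one_self)
  finally have "((1 + 16 * p) / (1 - p)) ^ i \<le> exp (18 * p) ^ i"
    using assms by (intro power_mono) auto
  then show ?thesis by (simp add: exp_of_nat_mult[symmetric] mult_ac)
qed

lemma f_err_le_powr:
  fixes p \<epsilon> :: real
  assumes p: "0 < p" "p \<le> 1 / 100" and x: "1 \<le> p * real n" and n: "1 \<le> n" and eps: "0 < \<epsilon>"
    and i: "real i \<le> \<epsilon> * (1 / 2 ^ 10) * inverse p * ln (p * real n)"
  shows "f_err n p i \<le> (p * real n) powr (\<epsilon> / 50) *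
    (4 * ln (real n) * (sqrt (ln (p * real n) / (p * real n)) + sqrt p))"
proof -
  have "18 * p * real i \<le> 18 * p * (\<epsilon> * (1 / 2 ^ 10) * inverse p * ln (p * real n))"
    using i p by (intro mult_left_mono) auto
  also have "\<dots> = (18 / 2 ^ 10) * (\<epsilon> * ln (p * real n))" using p by simp
  \<comment> \<open>\<open>18 * 50 = 900 < 2 ^ 10\<close>; the smallness of the constant in
    \<open>k\<close> is spent here.\<close>
  also have "\<dots> \<le> (1 / 50) * (\<epsilon> * ln (p * real n))"
    using x eps by (intro mult_right_mono) auto
  finally have "exp (18 * p * real i) \<le> (p * real n) powr (\<epsilon> / 50)"
    using x p n by (simp add: powr_def)
  with growth_factor_power_le[OF p, of i]
  have "((1 + 16 * p) / (1 - p)) ^ i \<le> (p * real n) powr (\<epsilon> / 50)" by simp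
  moreover have "sqrt (ln (p * real n) / (p * real n) + p) \<le>
      sqrt (ln (p * real n) / (p * real n)) + sqrt p"
    using x p by (intro sqrt_add_le_add_sqrt) auto
  ultimately show ?thesis
    unfolding f_err_def using n p x by (intro mult_mono) auto
qed

lemma sqrt_ln_over_self_le:
  fixes x \<delta> :: real
  assumes "1 \<le> x" "0 < \<delta>"
  shows "sqrt (ln x / x) \<le> x powr (\<delta> / 2 - 1 / 2) / sqrt \<delta>"
proof -
  have "ln x / x \<le> x powr \<delta> / \<delta> / x"
    using assms ln_powr_bound[of x \<delta>] by (intro divide_right_mono) auto
  also have "\<dots> = x powr (\<delta> - 1) / \<delta>" using assms by (simp add: powr_diff)
  finally have "sqrt (ln x / x) \<le> sqrt (x powr (\<delta> - 1) / \<delta>)" by simp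
  also have "\<dots> = x powr (\<delta> / 2 - 1 / 2) / sqrt \<delta>"
    using assms by (simp add: real_sqrt_divide powr_half_sqrt[symmetric] powr_powr diff_divide_distrib)
  finally show ?thesis .
qed

text \<open>After splitting the root, the lower bound on \<open>p\<close> controls the term
  \<open>ln x / x\<close> and the upper bound on \<open>p\<close> controls the term
  \<open>p\<close>; each contributes at most \<open>1 / 40\<close>.\<close>

lemma eventually_f_err_le:
  fixes \<epsilon> :: real and p :: "nat \<Rightarrow> real"
  assumes eps: "0 < \<epsilon>" "\<epsilon> < 1 / 2 ^ 10"
    and p: "\<forall>\<^sub>F n in sequentially.
      ln (real n) powr (2 + \<epsilon>) * inverse (real n) \<le> p n \<and> p n < real n powr (- \<epsilon>)"
  shows "\<forall>\<^sub>F n in sequentially. 0 < p n \<and> p n \<le> 1 / 100 \<and> 100 \<le> ln (p n * real n) \<and>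
    (\<forall>i. real i \<le> \<epsilon> * (1 / 2 ^ 10) * inverse (p n) * ln (p n * real n) \<longrightarrow> f_err n (p n) i \<le> 1 / 20)"
proof -
  \<comment> \<open>The power of \<open>ln n\<close> left once
    \<open>x \<ge> (ln n) powr (2 + \<epsilon>)\<close> is inserted;
    \<open>3 * \<epsilon> / 100\<close> is \<open>\<epsilon> / 50\<close> from the growth factor
    plus half of \<open>\<epsilon> / 50\<close> from bounding the logarithm.\<close>
  define c where "c = (2 + \<epsilon>) * (3 * \<epsilon> / 100 - 1 / 2) + 1"
  have c: "c < 0"
  proof -
    \<comment> \<open>The constants cancel, and the term \<open>- \<epsilon> / 2\<close>, due to the
      excess of the exponent over 2, dominates.\<close>
    have "c = \<epsilon> * (6 / 100 - 1 / 2 + 3 * \<epsilon> / 100)" by (simp add: c_def field_simps)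
    then show ?thesis using eps by (simp add: mult_pos_neg)
  qed
  have e1: "\<forall>\<^sub>F n in sequentially. real n powr (- \<epsilon>) \<le> 1 / 100"
    using eps by real_asymp
  have e2: "\<forall>\<^sub>F n in sequentially. exp 100 \<le> ln (real n) powr (2 + \<epsilon>)"
    using eps by real_asymp
  have e3: "\<forall>\<^sub>F n in sequentially. 4 * ln (real n) * real n powr (\<epsilon> / 50 - \<epsilon> / 2) \<le> 1 / 40"
    using eps by real_asymp
  have e4: "\<forall>\<^sub>F n in sequentially. 4 / sqrt (\<epsilon> / 50) * ln (real n) powr c \<le> 1 / 40"
    using c eps by real_asymp
  have e5: "\<forall>\<^sub>F n in sequentially. 1 \<le> ln (real n)"
    by real_asymp
  show ?thesis
    using p e1 e2 e3 e4 e5 eventually_ge_at_top[of 1]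
  proof eventually_elim
    case (elim n)
    define x where "x = p n * real n"
    define L where "L = ln (real n)"
    have n: "1 \<le> n" "0 < real n" using elim by auto
    have L: "1 \<le> L" using elim by (simp add: L_def)
    have Lx: "L powr (2 + \<epsilon>) \<le> x"
      using elim n by (simp add: x_def L_def field_simps)
    have x: "exp 100 \<le> x" using Lx elim by (simp add: L_def)
    then have x0: "0 < x" by (meson exp_gt_zero less_le_trans)
    have x1: "1 \<le> x" using x by (meson order_trans one_le_exp_iff zero_le_numeral)
    have p0: "0 < p n" using x0 n by (simp add: x_def zero_less_mult_iff)
    have p1: "p n \<le> 1 / 100" using elim by linarith
    have "p n * real n \<le> 1 * real n" using p1 by (intro mult_right_mono) auto
    then have xn: "x \<le> real n" by (simp add: x_def)
    have lnx: "100 \<le> ln x" using x x0 by (simp add: ln_ge_iff)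
    have "x powr (\<epsilon> / 50) * (4 * L * sqrt (ln x / x)) \<le>
        x powr (\<epsilon> / 50) * (4 * L * (x powr (\<epsilon> / 50 / 2 - 1 / 2) / sqrt (\<epsilon> / 50)))"
      using x1 L eps by (intro mult_left_mono sqrt_ln_over_self_le) auto
    also have "\<dots> = 4 / sqrt (\<epsilon> / 50) * (L * x powr (3 * \<epsilon> / 100 - 1 / 2))"
    proof -
      have "x powr (3 * \<epsilon> / 100 - 1 / 2) = x powr (\<epsilon> / 50) * x powr (\<epsilon> / 50 / 2 - 1 / 2)"
        by (simp add: powr_add[symmetric])
      then show ?thesis by simp
    qed
    \<comment> \<open>The exponent is negative, so the lower bound on \<open>x\<close> bounds its
      power from above.\<close>
    also have "\<dots> \<le> 4 / sqrt (\<epsilon> / 50) * (L * (L powr (2 + \<epsilon>)) powr (3 * \<epsilon> / 100 - 1 / 2))"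
      using Lx L eps by (intro mult_left_mono powr_mono2') auto
    also have "L * (L powr (2 + \<epsilon>)) powr (3 * \<epsilon> / 100 - 1 / 2) = L powr c"
      unfolding powr_powr using L by (simp add: c_def powr_add)
    also have "4 / sqrt (\<epsilon> / 50) * L powr c \<le> 1 / 40" using elim by (simp add: L_def)
    finally have t1: "x powr (\<epsilon> / 50) * (4 * L * sqrt (ln x / x)) \<le> 1 / 40" .
    have "sqrt (p n) \<le> sqrt (real n powr (- \<epsilon>))" using elim by simp
    also have "\<dots> = real n powr (- \<epsilon> / 2)" by (simp add: powr_half_sqrt[symmetric] powr_powr)
    finally have "sqrt (p n) \<le> real n powr (- \<epsilon> / 2)" .
    then have "x powr (\<epsilon> / 50) * (4 * L * sqrt (p n)) \<le>
        real n powr (\<epsilon> / 50) * (4 * L * real n powr (- \<epsilon> / 2))"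
      using xn x0 L p0 eps by (intro mult_mono powr_mono2) auto
    also have "\<dots> = 4 * L * real n powr (\<epsilon> / 50 - \<epsilon> / 2)"
      using powr_add[of "real n" "\<epsilon> / 50" "- \<epsilon> / 2"] by simp
    also have "\<dots> \<le> 1 / 40" using elim by (simp add: L_def)
    finally have t2: "x powr (\<epsilon> / 50) * (4 * L * sqrt (p n)) \<le> 1 / 40" .
    have "f_err n (p n) i \<le> 1 / 20"
      if "real i \<le> \<epsilon> * (1 / 2 ^ 10) * inverse (p n) * ln (p n * real n)" for i
    proof -
      have "f_err n (p n) i \<le> x powr (\<epsilon> / 50) * (4 * L * (sqrt (ln x / x) + sqrt (p n)))"
        using f_err_le_powr[OF p0 p1 _ n(1) eps(1) that] x1 by (simp add: x_def L_def)
      also have "\<dots> \<le> 1 / 40 + 1 / 40"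
        using t1 t2 by (simp add: algebra_simps)
      finally show ?thesis by simp
    qed
    then show ?case using p0 p1 lnx by (simp add: x_def)
  qed
qed

text \<open>\<open>ln n \<ge> 1\<close> gives \<open>n \<ge> 2\<close>, so the prefactor is at most
  \<open>n ^ 4\<close>, which a fraction of the exponent pays for.\<close>

lemma union_bound_le_powr:
  assumes "1 \<le> ln (real n)" "100 \<le> y"
  shows "4 * (real n)\<^sup>2 * exp (- (ln (real n) * y / 16)) \<le> real n powr (- (1 / 2 ^ 11) * y)"
proof -
  define L where "L = ln (real n)"
  have n: "0 < real n" using assms by (cases "n = 0") auto
  have sq: "(real n)\<^sup>2 = exp (2 * L)"
    using n by (simp add: L_def exp_double)
  have "2 \<le> real n"
    using assms ln_le_minus_one[OF n] by linarith
  then have "2\<^sup>2 \<le> (real n)\<^sup>2" by (intro power_mono) auto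
  then have "4 \<le> exp (2 * L)" by (simp add: sq)
  with sq have "4 * (real n)\<^sup>2 \<le> exp (2 * L) * exp (2 * L)" by simp
  then have "4 * (real n)\<^sup>2 * exp (- (L * y / 16)) \<le> exp (2 * L) * exp (2 * L) * exp (- (L * y / 16))"
    by (intro mult_right_mono) auto
  also have "\<dots> = exp (4 * L - L * y / 16)" by (simp add: exp_add[symmetric])
  also have "\<dots> \<le> exp (- (1 / 2 ^ 11) * y * L)"
  proof -
    \<comment> \<open>For \<open>y \<ge> 100\<close> the right-hand factor exceeds 6, more than the
      4 needed.\<close>
    have "L * 4 \<le> L * (y * (1 / 16 - 1 / 2 ^ 11))"
      using assms by (intro mult_left_mono) (auto simp: L_def)
    then show ?thesis by (simp add: algebra_simps)
  qed
  also have "\<dots> = real n powr (- (1 / 2 ^ 11) * y)"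
    using n by (simp add: powr_def L_def)
  finally show ?thesis by (simp add: L_def)
qed

theorem theorem3p1:
  fixes \<epsilon> :: real and p :: "nat \<Rightarrow> real"
  assumes "0 < \<epsilon>" and "\<epsilon> < 1 / 2 ^ 10"
    and "\<forall>\<^sub>F n in sequentially.
           ln (real n) powr (2 + \<epsilon>) * inverse (real n) \<le> p n \<and> p n < real n powr (- \<epsilon>)"
  shows "\<forall>\<^sub>F n in sequentially. \<forall>G :: 'a pair_pre_digraph.
           pair_graph G \<and> card (pverts G) = n \<and> typical \<epsilon> (p n) G \<longrightarrow>
           (let k = \<epsilon> * (1 / 2 ^ 10) * inverse (p n) * ln (p n * real n) in
            measure_pmf.prob (greedy_process G)
              {vs. \<forall>i \<ge> 1. real i \<le> k - 1 \<longrightarrow>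
                 (\<forall>v \<in> avail G vs i. real (degree_in G (avail G vs i) v) \<in>
                    {(1 - f_err n (p n) i) * d_tilde n (p n) i ..
                     (1 + f_err n (p n) i) * d_tilde n (p n) i})}
            \<ge> 1 - real n powr (- (1 / 2 ^ 11) * ln (p n * real n)))"
  using eventually_f_err_le[OF assms]
proof eventually_elim
  case (elim n)
  define k where "k = \<epsilon> * (1 / 2 ^ 10) * inverse (p n) * ln (p n * real n)"
  have "1 - real n powr (- (1 / 2 ^ 11) * ln (p n * real n)) \<le>
      measure_pmf.prob (greedy_process G)
        {vs. \<forall>i \<ge> 1. real i \<le> k - 1 \<longrightarrow>
           (\<forall>v \<in> avail G vs i. real (degree_in G (avail G vs i) v) \<in>
              {(1 - f_err n (p n) i) * d_tilde n (p n) i ..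
               (1 + f_err n (p n) i) * d_tilde n (p n) i})}" (is "_ \<le> measure_pmf.prob _ ?E")
    if G: "pair_graph G" "card (pverts G) = n" "typical \<epsilon> (p n) G" for G :: "'a pair_pre_digraph"
  proof -
    interpret G: pair_graph G by (rule G(1))
    interpret G: typical_process G \<epsilon> "p n" k
    proof
      have "\<epsilon> * (1 / 2 ^ 10) \<le> \<epsilon>" using assms by simp
      then have "\<epsilon> * (1 / 2 ^ 10) * (inverse (p n) * ln (p n * real n)) \<le>
          \<epsilon> * (inverse (p n) * ln (p n * real n))"
        using elim by (intro mult_right_mono) auto
      then show "k \<le> \<epsilon> * inverse (p n) * ln (p n * real (card (pverts G)))"
        by (simp add: k_def G(2) mult.assoc)
    qed (use G elim assms in \<open>auto simp: k_def\<close>)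
    have "4 * (real n)\<^sup>2 * exp (- (ln (real n) * ln (p n * real n) / 16)) \<le>
        real n powr (- (1 / 2 ^ 11) * ln (p n * real n))"
      using G.ln_n_ge elim G(2) by (intro union_bound_le_powr) auto
    then have "1 - real n powr (- (1 / 2 ^ 11) * ln (p n * real n)) \<le>
        measure_pmf.prob (greedy_process G) {vs. \<forall>i. real i \<le> k \<longrightarrow> G.good i vs}"
      using G.all_good_prob by (simp add: G(2))
    \<comment> \<open>The windows were controlled for all \<open>0 \<le> i \<le> k\<close>, a longer
      range than required.\<close>
    also have "\<dots> \<le> measure_pmf.prob (greedy_process G) ?E"
      by (intro measure_pmf.finite_measure_mono) (auto simp: G.good_def G(2))
    finally show ?thesis .
  qed
  then show ?case by (auto simp: Let_def k_def)
qed

end
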